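(* For any $k$-uniform hypergraph $G(V,E)$, $\gamma(G)\ge k-1$.
   Context: A bicoloring of $G$ is a map $X:V\to\{0,1\}$; a bicoloring cover of $G$ is a set of bicolorings such that every hyperedge is non-monochromatic under at least one of them; $\chi^c(G)$ is the minimum size of a bicoloring cover. Let $C_1,\dots,C_w$ be all (labeled) bicoloring covers of $G$ of size exactly $\chi^c(G)$ (optimal covers). For an optimal cover $C_i=\{X^i_1,\dots,X^i_{\chi^c(G)}\}$, each vertex $v$ gets the color bit vector $B^i_v=(X^i_1(v),\dots,X^i_{\chi^c(G)}(v))$; this partitions $V$ into classes of vertices with identical bit vectors. Let $\gamma_i(G)$ be the size of the largest such class, and define the cover independence number $\gamma(G)=\max_{1\le i\le w}\gamma_i(G)$.
   Formalization: The formal statement assumes |V| ≥ k−1, which holds whenever G has a hyperedge; without it the claim fails, e.g. for a single vertex, no hyperedges and k = 3, where γ(G) = 1 < 2. *)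

theory Defs
  imports Main "HOL-Library.FuncSet"
begin

definition uniform_hypergraph :: "nat \<Rightarrow> 'a set \<Rightarrow> 'a set set \<Rightarrow> bool" where
  "uniform_hypergraph k V E \<longleftrightarrow> finite V \<and> (\<forall>e\<in>E. e \<subseteq> V \<and> card e = k)"

(* Bicolorings are extensional on V, so that distinct ones differ at a vertex of V and
   cardinalities of sets of bicolorings have their intended meaning. *)
definition bicolorings :: "'a set \<Rightarrow> ('a \<Rightarrow> nat) set" where
  "bicolorings V = V \<rightarrow>\<^sub>E {0, 1}"

definition monochromatic :: "('a \<Rightarrow> nat) \<Rightarrow> 'a set \<Rightarrow> bool" where
  "monochromatic X e \<longleftrightarrow> (\<exists>c. \<forall>v\<in>e. X v = c)"

definition bicoloring_cover :: "'a set \<Rightarrow> 'a set set \<Rightarrow> ('a \<Rightarrow> nat) set \<Rightarrow> bool" where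
  "bicoloring_cover V E C \<longleftrightarrow>
     C \<subseteq> bicolorings V \<and> (\<forall>e\<in>E. \<exists>X\<in>C. \<not> monochromatic X e)"

(* For finite V, a cover exists iff no hyperedge has fewer than two vertices;
   otherwise the value is unspecified. *)
definition bicoloring_cover_number :: "'a set \<Rightarrow> 'a set set \<Rightarrow> nat" where
  "bicoloring_cover_number V E = (LEAST m. \<exists>C. bicoloring_cover V E C \<and> card C = m)"

(* A labeled cover is an enumeration, without repetition, of a set of bicolorings;
   the labeling fixes the order of the entries in the color bit vectors. *)
definition optimal_covers :: "'a set \<Rightarrow> 'a set set \<Rightarrow> ('a \<Rightarrow> nat) list set" where
  "optimal_covers V E =
     {Xs. distinct Xs \<and> bicoloring_cover V E (set Xs) \<and> length Xs = bicoloring_cover_number V E}"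

definition color_bit_vector :: "('a \<Rightarrow> nat) list \<Rightarrow> 'a \<Rightarrow> nat list" where
  "color_bit_vector Xs v = map (\<lambda>X. X v) Xs"

definition bit_vector_classes :: "'a set \<Rightarrow> ('a \<Rightarrow> nat) list \<Rightarrow> 'a set set" where
  "bit_vector_classes V Xs =
     V // {(u, v). u \<in> V \<and> v \<in> V \<and> color_bit_vector Xs u = color_bit_vector Xs v}"

definition largest_class_size :: "'a set \<Rightarrow> ('a \<Rightarrow> nat) list \<Rightarrow> nat" where
  "largest_class_size V Xs = Max (card ` bit_vector_classes V Xs)"

definition cover_independence_number :: "'a set \<Rightarrow> 'a set set \<Rightarrow> nat" where
  "cover_independence_number V E = Max (largest_class_size V ` optimal_covers V E)"

end

(* Take an optimal cover and the class B of some vertex u. If B has fewer than k - 1 vertices,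
   enlarge B to a set A of k - 1 vertices and give all of A the bit vector of u. A hyperedge is
   monochromatic under all bicolorings iff it lies in one class; the class A is too small to contain
   a hyperedge and every other class has only shrunk, so the recoloring is again a cover. It is
   optimal because merging two of its bicolorings would yield a smaller cover. *)
theory Submission
  imports Defs
begin

lemma finite_bicolorings:
  "finite V \<Longrightarrow> finite (bicolorings V)"
  by (simp add: bicolorings_def finite_PiE)

text \<open>An edge with two distinct vertices is split by the indicator function of one of them.
  This makes covers exist, so that the \<open>LEAST\<close> in
  \<open>bicoloring_cover_number\<close> is attained.\<close>

lemma bicoloring_cover_bicolorings:
  assumes "\<forall>e\<in>E. e \<subseteq> V \<and> 2 \<le> card e"
  shows "bicoloring_cover V E (bicolorings V)"
  unfolding bicoloring_cover_def
proof (intro conjI ballI)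
  fix e assume "e \<in> E"
  with assms have e: "e \<subseteq> V" "2 \<le> card e" by auto
  then obtain x y where xy: "x \<in> e" "y \<in> e" "x \<noteq> y"
    by (auto simp: numeral_2_eq_2 card_le_Suc_iff)
  let ?X = "\<lambda>v\<in>V. if v = x then 1 else (0::nat)"
  have "?X \<in> bicolorings V" by (auto simp: bicolorings_def)
  moreover have "?X x \<noteq> ?X y" using xy e by auto
  then have "\<not> monochromatic ?X e"
    using xy unfolding monochromatic_def by metis
  ultimately show "\<exists>X\<in>bicolorings V. \<not> monochromatic X e" by blast
qed simp

lemma bicoloring_cover_number_le:
  "bicoloring_cover V E C \<Longrightarrow> bicoloring_cover_number V E \<le> card C"
  unfolding bicoloring_cover_number_def by (rule Least_le) blast

lemma optimal_covers_nonempty: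
  assumes "finite V" "bicoloring_cover V E C"
  shows "optimal_covers V E \<noteq> {}"
proof -
  have "\<exists>D. bicoloring_cover V E D \<and> card D = bicoloring_cover_number V E"
    unfolding bicoloring_cover_number_def by (rule LeastI_ex) (use assms(2) in blast)
  then obtain D where D: "bicoloring_cover V E D" "card D = bicoloring_cover_number V E"
    by blast
  then have "finite D"
    using finite_bicolorings[OF assms(1)] by (auto simp: bicoloring_cover_def intro: finite_subset)
  then obtain Xs where "set Xs = D" "distinct Xs"
    using finite_distinct_list by blast
  with D have "Xs \<in> optimal_covers V E"
    by (auto simp: optimal_covers_def distinct_card[symmetric])
  then show ?thesis by blast
qed

text \<open>Distinctness comes for free: a repeated entry would make \<open>set Xs\<close> a cover
  with fewer elements than the minimum. Recolorings that might coincide are handled this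
  way.\<close>

lemma optimal_coversI:
  assumes "bicoloring_cover V E (set Xs)" "length Xs = bicoloring_cover_number V E"
  shows "Xs \<in> optimal_covers V E"
proof -
  have "card (set Xs) = length Xs"
    using bicoloring_cover_number_le[OF assms(1)] assms(2) card_length[of Xs] by simp
  then show ?thesis
    using assms by (simp add: optimal_covers_def card_distinct)
qed

lemma finite_optimal_covers:
  assumes "finite V"
  shows "finite (optimal_covers V E)"
  by (rule finite_subset[OF _ finite_lists_length_eq[OF finite_bicolorings[OF assms]]])
    (auto simp: optimal_covers_def bicoloring_cover_def)

text \<open>\<open>Max\<close> bounds its elements only on finite sets, so finiteness of
  \<open>V\<close> enters twice: for the quotient into classes and for the set of optimal
  covers.\<close>

lemma card_class_le_cover_independence_number:
  assumes "finite V" "Xs \<in> optimal_covers V E" "u \<in> V"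
  shows "card {v \<in> V. color_bit_vector Xs v = color_bit_vector Xs u}
           \<le> cover_independence_number V E"
proof -
  let ?R = "{(u, v). u \<in> V \<and> v \<in> V \<and> color_bit_vector Xs u = color_bit_vector Xs v}"
  have "?R `` {u} = {v \<in> V. color_bit_vector Xs v = color_bit_vector Xs u}"
    using assms(3) by auto
  then have "{v \<in> V. color_bit_vector Xs v = color_bit_vector Xs u} \<in> bit_vector_classes V Xs"
    unfolding bit_vector_classes_def using quotientI[OF assms(3), of ?R] by simp
  moreover have "finite (bit_vector_classes V Xs)"
    unfolding bit_vector_classes_def by (rule finite_quotient) (use assms(1) in auto)
  ultimately have "card {v \<in> V. color_bit_vector Xs v = color_bit_vector Xs u}
      \<le> largest_class_size V Xs"
    unfolding largest_class_size_def by (intro Max_ge) auto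
  also have "\<dots> \<le> cover_independence_number V E"
    unfolding cover_independence_number_def
    using assms finite_optimal_covers by (intro Max_ge) auto
  finally show ?thesis .
qed

lemma recolored_cover:
  fixes V A :: "'a set" and u :: 'a
  defines "recolor \<equiv> \<lambda>X v. if v \<in> A then X u else (X v :: nat)"
  assumes cover: "bicoloring_cover V E (set Xs)"
    and u: "u \<in> V" and A: "A \<subseteq> V"
    and B: "{v \<in> V. color_bit_vector Xs v = color_bit_vector Xs u} \<subseteq> A"
    and E: "\<forall>e\<in>E. e \<subseteq> V \<and> \<not> e \<subseteq> A"
  shows "bicoloring_cover V E (set (map recolor Xs))"
  unfolding bicoloring_cover_def
proof (intro conjI ballI subsetI)
  fix Y assume "Y \<in> set (map recolor Xs)"
  then obtain X where "X \<in> set Xs" "Y = recolor X" by auto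
  moreover from this cover have "X \<in> V \<rightarrow>\<^sub>E {0, 1}"
    unfolding bicoloring_cover_def bicolorings_def by blast
  \<comment> \<open>\<open>u \<in> V\<close> keeps the new values in \<open>{0, 1}\<close>;
    \<open>A \<subseteq> V\<close> keeps \<open>Y\<close> undefined outside
    \<open>V\<close>.\<close>
  ultimately show "Y \<in> bicolorings V"
    using u A unfolding bicolorings_def recolor_def PiE_iff extensional_def by auto
next
  fix e assume e: "e \<in> E"
  then obtain w where w: "w \<in> e" "w \<notin> A" "w \<in> V" using E by blast
  show "\<exists>Y\<in>set (map recolor Xs). \<not> monochromatic Y e"
  proof (cases "e \<inter> A = {}")
    case True
    from cover e obtain X where X: "X \<in> set Xs" "\<not> monochromatic X e"
      unfolding bicoloring_cover_def by blast
    have "recolor X v = X v" if "v \<in> e" for v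
      using True that by (auto simp: recolor_def)
    with X(2) have "\<not> monochromatic (recolor X) e"
      by (simp add: monochromatic_def)
    with X(1) show ?thesis by auto
  next
    case False
    then obtain x where x: "x \<in> e" "x \<in> A" by blast
    \<comment> \<open>\<open>A\<close> contains the whole class of \<open>u\<close>, so
      \<open>w\<close> lies outside that class. It keeps its old vector, whereas \<open>x\<close>
      now carries the vector of \<open>u\<close>.\<close>
    from w B have "color_bit_vector Xs w \<noteq> color_bit_vector Xs u" by auto
    then obtain X where X: "X \<in> set Xs" "X w \<noteq> X u"
      by (auto simp: color_bit_vector_def)
    with x w have "recolor X w \<noteq> recolor X x" by (simp add: recolor_def)
    with x w have "\<not> monochromatic (recolor X) e"
      unfolding monochromatic_def by metis
    with X show ?thesis by auto
  qed
qed

theorem theorem6: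
  fixes V :: "'a set" and E :: "'a set set" and k :: nat
  assumes "uniform_hypergraph k V E"
    and "card V \<ge> k - 1"
  shows "cover_independence_number V E \<ge> k - 1"
proof (cases "k \<ge> 2")
  case False
  \<comment> \<open>Here \<open>k - 1\<close> is 0 by truncated subtraction.\<close>
  then show ?thesis by simp
next
  case True
  have V: "finite V" and E: "\<forall>e\<in>E. e \<subseteq> V \<and> card e = k"
    using assms(1) by (auto simp: uniform_hypergraph_def)
  have "bicoloring_cover V E (bicolorings V)"
    using E True by (intro bicoloring_cover_bicolorings) auto
  then obtain Xs where Xs: "Xs \<in> optimal_covers V E"
    using optimal_covers_nonempty[OF V] by blast
  have "V \<noteq> {}" using True assms(2) by auto
  then obtain u where u: "u \<in> V" by blast
  define B where "B = {v \<in> V. color_bit_vector Xs v = color_bit_vector Xs u}"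
  show ?thesis
  proof (cases "k - 1 \<le> card B")
    case True
    then show ?thesis
      using card_class_le_cover_independence_number[OF V Xs u] by (simp add: B_def)
  next
    case False
    have "B \<subseteq> V" by (auto simp: B_def)
    \<comment> \<open>The bound on \<open>card V\<close> leaves enough vertices to enlarge
      \<open>B\<close>.\<close>
    with False obtain A where A: "B \<subseteq> A" "A \<subseteq> V" "card A = k - 1"
      using exists_subset_between[of B "k - 1" V] assms(2) V by auto
    define Ys where "Ys = map (\<lambda>X v. if v \<in> A then X u else X v) Xs"
    \<comment> \<open>An edge has \<open>k\<close> vertices, and \<open>k - 1 < k\<close> since
      \<open>k\<close> is positive.\<close>
    have "\<not> e \<subseteq> A" if "e \<in> E" for e
      using card_mono[of A e] A V E that True by (auto dest: finite_subset)
    then have "bicoloring_cover V E (set Ys)"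
      unfolding Ys_def using Xs u A E
      by (intro recolored_cover) (auto simp: B_def optimal_covers_def)
    then have Ys: "Ys \<in> optimal_covers V E"
      using Xs by (intro optimal_coversI) (auto simp: Ys_def optimal_covers_def)
    \<comment> \<open>Recoloring leaves the vector of \<open>u\<close> itself unchanged, and all of
      \<open>A\<close> receives it.\<close>
    have "A \<subseteq> {v \<in> V. color_bit_vector Ys v = color_bit_vector Ys u}"
      using A u by (auto simp: Ys_def color_bit_vector_def)
    then have "card A \<le> card {v \<in> V. color_bit_vector Ys v = color_bit_vector Ys u}"
      using V by (intro card_mono) auto
    also have "\<dots> \<le> cover_independence_number V E"
      by (rule card_class_le_cover_independence_number[OF V Ys u])
    finally show ?thesis using A by simp
  qed
qed

end
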